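(* Let $(X,\Pi)$ be a $d$-dimensional weighted pure simplicial complex, $0\le k\le d$, and $f\in C_k$, with Bottom-Up level functions $g_i\in C_i$ and lifts $f_i=\binom{k}{i}U^k_ig_i\in C_k$. Then: (1) $f=\sum_{i=0}^kf_i$; (2) for every $0\le i\le k$, \[ g_i=\sum_{j=0}^i(-1)^{i-j}\binom{i}{j}U^i_jD^k_jf,\qquad f_i=\binom{k}{i}\sum_{j=0}^i(-1)^{i-j}\binom{i}{j}U^k_jD^k_jf; \] equivalently, for all $\tau\in X(i)$, $g_i(\tau)=\sum_{\sigma\subseteq\tau}(-1)^{|\tau\setminus\sigma|}\mathbb{E}_{X_\sigma}[f]$, and for all $\tau\in X(k)$, $f_i(\tau)=\sum_{\sigma\in X(i),\sigma\subseteq\tau}g_i(\sigma)$.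
   Context: A $d$-dimensional pure simplicial complex $X$ on $[n]$: a nonempty $X(d)\subseteq\binom{[n]}{d}$ with downward closure $X(i)=\{s\in\binom{[n]}{i}:\exists t\in X(d),s\subseteq t\}$ (an $i$-face has $i$ elements). Weighted: distribution $\pi_d=\Pi$ on $X(d)$, $\pi_i(x)=\frac{1}{i+1}\sum_{y\in X(i+1),y\supset x}\pi_{i+1}(y)$. $C_i$: functions $X(i)\to\mathbb{R}$. $U_i:C_i\to C_{i+1}$, $U_if(\tau)=\frac{1}{i+1}\sum_{\sigma\in X(i),\sigma\subset\tau}f(\sigma)$; $D_{i+1}:C_{i+1}\to C_i$, $D_{i+1}f(\tau)=\sum_{\sigma\in X(i+1),\sigma\supset\tau}\pi_{i+1}(\sigma)f(\sigma)/\sum_{\sigma\in X(i+1),\sigma\supset\tau}\pi_{i+1}(\sigma)$. For $j\le i$: $U^i_j=U_{i-1}\circ\cdots\circ U_j:C_j\to C_i$, $D^i_j=D_{j+1}\circ\cdots\circ D_i:C_i\to C_j$ (identity if $i=j$). For $f\in C_k$ and $\sigma\in X(j)$, $\mathbb{E}_{X_\sigma}[f]=D^k_jf(\sigma)$, the $\pi_k$-weighted average of $f$ over $k$-faces containing $\sigma$. The Bottom-Up level functions of $f\in C_k$ are defined recursively by $g_i=D^k_if-\sum_{j=0}^{i-1}\binom{i}{j}U^i_jg_j$. *)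

theory Defs
  imports "HOL-Probability.Probability"
begin

text \<open>
  A complex is given by its set of top faces \<open>T\<close> (that is, \<open>X(d)\<close>), and the weight \<open>P\<close> is a
  probability mass function carried by \<open>T\<close>.  An \<open>i\<close>-face has \<open>i\<close> elements.  As in the source,
  \<open>P\<close> is not required to give every top face a positive mass; a quotient whose denominator
  vanishes is then \<open>0\<close>.
\<close>

definition weighted_pure_complex :: "nat \<Rightarrow> nat \<Rightarrow> nat set set \<Rightarrow> nat set pmf \<Rightarrow> bool" where
  "weighted_pure_complex n d T P \<longleftrightarrow>
     T \<noteq> {} \<and> T \<subseteq> {s. s \<subseteq> {1..n} \<and> card s = d} \<and> set_pmf P \<subseteq> T"

definition faces :: "nat set set \<Rightarrow> nat \<Rightarrow> nat set set" where
  "faces T i = {s. card s = i \<and> (\<exists>t\<in>T. s \<subseteq> t)}"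

text \<open>Only the values for \<open>i \<le> d\<close> are meaningful.\<close>

function face_weight :: "nat \<Rightarrow> nat set set \<Rightarrow> nat set pmf \<Rightarrow> nat \<Rightarrow> nat set \<Rightarrow> real" where
  "face_weight d T P i x =
     (if i < d
      then 1 / real (i + 1) * (\<Sum>y | y \<in> faces T (i + 1) \<and> x \<subset> y. face_weight d T P (i + 1) y)
      else pmf P x)"
  by pat_completeness auto
termination by (relation "Wellfounded.measure (\<lambda>(d, T, P, i, x). d - i)") auto

declare face_weight.simps [simp del]

text \<open>
  Elements of \<open>C\<^sub>i\<close> are represented by total functions on \<open>nat set\<close>, of which only the values on
  \<open>faces T i\<close> matter; equality in \<open>C\<^sub>i\<close> is equality on \<open>faces T i\<close>.
  \<open>up_op T i\<close> is \<open>U\<^sub>i\<close>, mapping \<open>C\<^sub>i\<close> to \<open>C\<close> with index \<open>i + 1\<close>;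
  \<open>down_op d T P i\<close> is \<open>D\<^sub>i\<close>, mapping \<open>C\<^sub>i\<close> to \<open>C\<close> with index \<open>i - 1\<close>.
\<close>

definition up_op :: "nat set set \<Rightarrow> nat \<Rightarrow> (nat set \<Rightarrow> real) \<Rightarrow> nat set \<Rightarrow> real" where
  "up_op T i f \<tau> = 1 / real (i + 1) * (\<Sum>\<sigma> | \<sigma> \<in> faces T i \<and> \<sigma> \<subset> \<tau>. f \<sigma>)"

definition down_op ::
  "nat \<Rightarrow> nat set set \<Rightarrow> nat set pmf \<Rightarrow> nat \<Rightarrow> (nat set \<Rightarrow> real) \<Rightarrow> nat set \<Rightarrow> real" where
  "down_op d T P i f \<tau> =
     (\<Sum>\<sigma> | \<sigma> \<in> faces T i \<and> \<tau> \<subset> \<sigma>. face_weight d T P i \<sigma> * f \<sigma>) /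
     (\<Sum>\<sigma> | \<sigma> \<in> faces T i \<and> \<tau> \<subset> \<sigma>. face_weight d T P i \<sigma>)"

text \<open>
  For \<open>j \<le> i\<close>, \<open>up_comp T j i\<close> raises the index from \<open>j\<close> to \<open>i\<close> (applying \<open>U\<^sub>j\<close> first), and
  \<open>down_comp d T P i j\<close> lowers it from \<open>i\<close> to \<open>j\<close> (applying \<open>D\<^sub>i\<close> first).
\<close>

definition up_comp ::
  "nat set set \<Rightarrow> nat \<Rightarrow> nat \<Rightarrow> (nat set \<Rightarrow> real) \<Rightarrow> nat set \<Rightarrow> real" where
  "up_comp T j i f = fold (up_op T) [j..<i] f"

definition down_comp ::
  "nat \<Rightarrow> nat set set \<Rightarrow> nat set pmf \<Rightarrow> nat \<Rightarrow> nat \<Rightarrow> (nat set \<Rightarrow> real) \<Rightarrow> nat set \<Rightarrow> real" where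
  "down_comp d T P i j f = foldr (down_op d T P) [Suc j..<Suc i] f"

definition link_expectation ::
  "nat \<Rightarrow> nat set set \<Rightarrow> nat set pmf \<Rightarrow> nat \<Rightarrow> (nat set \<Rightarrow> real) \<Rightarrow> nat set \<Rightarrow> real" where
  "link_expectation d T P k f \<sigma> = down_comp d T P k (card \<sigma>) f \<sigma>"

fun level_fun ::
  "nat \<Rightarrow> nat set set \<Rightarrow> nat set pmf \<Rightarrow> nat \<Rightarrow> (nat set \<Rightarrow> real) \<Rightarrow> nat \<Rightarrow> nat set \<Rightarrow> real" where
  "level_fun d T P k f i =
     (\<lambda>\<tau>. down_comp d T P k i f \<tau> -
       (\<Sum>j\<in>{..<i}. real (i choose j) * up_comp T j i (level_fun d T P k f j) \<tau>))"

declare level_fun.simps [simp del]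

definition level_lift ::
  "nat \<Rightarrow> nat set set \<Rightarrow> nat set pmf \<Rightarrow> nat \<Rightarrow> (nat set \<Rightarrow> real) \<Rightarrow> nat \<Rightarrow> nat set \<Rightarrow> real" where
  "level_lift d T P k f i \<tau> = real (k choose i) * up_comp T i k (level_fun d T P k f i) \<tau>"


lemma finite_faces:
  assumes "weighted_pure_complex n d T P"
  shows "finite (faces T i)" and "s \<in> faces T i \<Longrightarrow> finite s"
proof -
  have "faces T i \<subseteq> Pow {1..n}"
    using assms unfolding weighted_pure_complex_def faces_def by blast
  then show "finite (faces T i)" "s \<in> faces T i \<Longrightarrow> finite s"
    using finite_subset[of "faces T i" "Pow {1..n}"] finite_subset[of s "{1..n}"] by blast+
qed

lemma face_weight_nonneg: "face_weight d T P i x \<ge> 0"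
proof (induction d T P i x rule: face_weight.induct)
  case (1 d T P i x)
  show ?case
  proof (cases "i < d")
    case True
    then have "(\<Sum>y | y \<in> faces T (i + 1) \<and> x \<subset> y. face_weight d T P (i + 1) y) \<ge> 0"
      using "1.IH" by (intro sum_nonneg) simp
    then show ?thesis using True by (subst face_weight.simps) simp
  next
    case False
    then show ?thesis by (subst face_weight.simps) simp
  qed
qed

lemma card_between:
  assumes "finite z" "card z = Suc k" "\<sigma> \<subseteq> z"
  shows "card {y. card y = k \<and> \<sigma> \<subseteq> y \<and> y \<subset> z} = Suc k - card \<sigma>"
proof -
  have "{y. card y = k \<and> \<sigma> \<subseteq> y \<and> y \<subset> z} = (\<lambda>v. z - {v}) ` (z - \<sigma>)"
  proof (intro equalityI subsetI)
    fix y assume y: "y \<in> {y. card y = k \<and> \<sigma> \<subseteq> y \<and> y \<subset> z}"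
    then have "card (z - y) = 1"
      using assms by (subst card_Diff_subset) (auto dest: finite_subset)
    then obtain v where "z - y = {v}" by (auto simp: card_1_singleton_iff)
    then have "y = z - {v}" "v \<in> z - \<sigma>" using y by auto
    then show "y \<in> (\<lambda>v. z - {v}) ` (z - \<sigma>)" by blast
  next
    fix y assume "y \<in> (\<lambda>v. z - {v}) ` (z - \<sigma>)"
    then show "y \<in> {y. card y = k \<and> \<sigma> \<subseteq> y \<and> y \<subset> z}" using assms by auto
  qed
  moreover have "inj_on (\<lambda>v. z - {v}) (z - \<sigma>)" by (auto simp: inj_on_def)
  ultimately show ?thesis
    using assms by (simp add: card_image card_Diff_subset finite_subset)
qed

lemma weighted_sum_step:
  assumes c: "weighted_pure_complex n d T P" and "k < d"
  shows "(\<Sum>y | y \<in> faces T k \<and> \<sigma> \<subseteq> y. face_weight d T P k y * down_op d T P (Suc k) f y) =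
         real (Suc k - card \<sigma>) / real (Suc k) *
           (\<Sum>z | z \<in> faces T (Suc k) \<and> \<sigma> \<subseteq> z. face_weight d T P (Suc k) z * f z)" (is ?A)
    and "(\<Sum>y | y \<in> faces T k \<and> \<sigma> \<subseteq> y. face_weight d T P k y) =
         real (Suc k - card \<sigma>) / real (Suc k) *
           (\<Sum>z | z \<in> faces T (Suc k) \<and> \<sigma> \<subseteq> z. face_weight d T P (Suc k) z)" (is ?B)
proof -
  let ?w = "face_weight d T P (Suc k)"
  let ?Y = "{y. y \<in> faces T k \<and> \<sigma> \<subseteq> y}" and ?Z = "{z. z \<in> faces T (Suc k) \<and> \<sigma> \<subseteq> z}"
  have fin: "finite ?Y" "finite ?Z" "\<And>y. finite {z. z \<in> faces T (Suc k) \<and> y \<subset> z}"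
    using finite_faces(1)[OF c] by auto
  have double: "(\<Sum>y\<in>?Y. \<Sum>z | z \<in> faces T (Suc k) \<and> y \<subset> z. h z) =
      real (Suc k - card \<sigma>) * (\<Sum>z\<in>?Z. h z)" for h :: "nat set \<Rightarrow> real"
  proof -
    have "(\<Sum>y\<in>?Y. \<Sum>z | z \<in> faces T (Suc k) \<and> y \<subset> z. h z) =
        (\<Sum>y\<in>?Y. \<Sum>z | z \<in> ?Z \<and> y \<subset> z. h z)"
      by (intro sum.cong) auto
    also have "\<dots> = (\<Sum>z\<in>?Z. \<Sum>y | y \<in> ?Y \<and> y \<subset> z. h z)"
      using fin by (intro sum.swap_restrict) auto
    also have "\<dots> = (\<Sum>z\<in>?Z. real (Suc k - card \<sigma>) * h z)"
    proof (rule sum.cong[OF refl])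
      fix z assume z: "z \<in> ?Z"
      have "{y. y \<in> ?Y \<and> y \<subset> z} = {y. card y = k \<and> \<sigma> \<subseteq> y \<and> y \<subset> z}"
        using z unfolding faces_def by blast
      moreover have "card {y. card y = k \<and> \<sigma> \<subseteq> y \<and> y \<subset> z} = Suc k - card \<sigma>"
        using z finite_faces(2)[OF c, of z "Suc k"] by (intro card_between) (simp_all add: faces_def)
      ultimately show "(\<Sum>y | y \<in> ?Y \<and> y \<subset> z. h z) = real (Suc k - card \<sigma>) * h z"
        by simp
    qed
    finally show ?thesis by (simp add: sum_distrib_left)
  qed
  have w: "face_weight d T P k y =
      1 / real (Suc k) * (\<Sum>z | z \<in> faces T (Suc k) \<and> y \<subset> z. ?w z)" for y
    using \<open>k < d\<close> by (subst face_weight.simps) simp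
  have wD: "face_weight d T P k y * down_op d T P (Suc k) f y =
      1 / real (Suc k) * (\<Sum>z | z \<in> faces T (Suc k) \<and> y \<subset> z. ?w z * f z)" for y
  proof (cases "(\<Sum>z | z \<in> faces T (Suc k) \<and> y \<subset> z. ?w z) = 0")
    case True
    then have "\<forall>z\<in>{z. z \<in> faces T (Suc k) \<and> y \<subset> z}. ?w z = 0"
      using fin(3) by (subst (asm) sum_nonneg_eq_0_iff) (auto simp: face_weight_nonneg)
    then show ?thesis using True by (simp add: w)
  next
    case False
    then show ?thesis by (simp add: w down_op_def)
  qed
  show ?A by (simp only: wD sum_distrib_left[symmetric] double) simp
  show ?B by (simp only: w sum_distrib_left[symmetric] double) simp
qed

text \<open>
  \<open>link_expectation\<close> is the weighted average over the \<open>k\<close>-faces containing \<open>\<sigma>\<close>.  For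
  \<open>card \<sigma> = k\<close> it is \<open>f \<sigma>\<close> by definition.
\<close>

lemma link_expectation_eq_average:
  assumes "weighted_pure_complex n d T P" and "card \<sigma> < k" and "k \<le> d"
  shows "link_expectation d T P k f \<sigma> =
    (\<Sum>\<tau> | \<tau> \<in> faces T k \<and> \<sigma> \<subseteq> \<tau>. face_weight d T P k \<tau> * f \<tau>) /
    (\<Sum>\<tau> | \<tau> \<in> faces T k \<and> \<sigma> \<subseteq> \<tau>. face_weight d T P k \<tau>)"
  using \<open>card \<sigma> < k\<close> \<open>k \<le> d\<close>
proof (induction k arbitrary: f)
  case (Suc k)
  show ?case
  proof (cases "card \<sigma> = k")
    case True
    have "{\<tau>. \<tau> \<in> faces T (Suc k) \<and> \<sigma> \<subset> \<tau>} = {\<tau>. \<tau> \<in> faces T (Suc k) \<and> \<sigma> \<subseteq> \<tau>}"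
      using True by (auto simp: faces_def)
    then show ?thesis using True by (simp add: link_expectation_def down_comp_def down_op_def)
  next
    case False
    then have "card \<sigma> < k" using Suc.prems by simp
    have "link_expectation d T P (Suc k) f \<sigma> = link_expectation d T P k (down_op d T P (Suc k) f) \<sigma>"
      using \<open>card \<sigma> < k\<close> by (simp add: link_expectation_def down_comp_def)
    moreover have "link_expectation d T P k (down_op d T P (Suc k) f) \<sigma> =
      (\<Sum>\<tau> | \<tau> \<in> faces T k \<and> \<sigma> \<subseteq> \<tau>. face_weight d T P k \<tau> * down_op d T P (Suc k) f \<tau>) /
      (\<Sum>\<tau> | \<tau> \<in> faces T k \<and> \<sigma> \<subseteq> \<tau>. face_weight d T P k \<tau>)"
      using \<open>card \<sigma> < k\<close> Suc.prems by (intro Suc.IH) simp_all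
    moreover have "k < d" "real (Suc k - card \<sigma>) / real (Suc k) \<noteq> 0"
      using \<open>card \<sigma> < k\<close> Suc.prems by auto
    ultimately show ?thesis
      by (simp only: weighted_sum_step[OF assms(1) \<open>k < d\<close>]) simp
  qed
qed simp

end

(* By double counting, \<open>binom(i, j) U\<^sup>i\<^sub>j g\<close> evaluated at an \<open>i\<close>-face is the sum of \<open>g\<close> over its
   \<open>j\<close>-subfaces.  The recursion for the level functions thus says that they sum over all subfaces
   of a face to its link expectation, and Moebius inversion on the Boolean lattice gives the
   closed formula. *)
theory Submission
  imports Defs
begin

lemma faces_downward:
  assumes "\<tau> \<in> faces T i" "\<sigma> \<subseteq> \<tau>"
  shows "\<sigma> \<in> faces T (card \<sigma>)"
  using assms unfolding faces_def by blast

lemma faces_finite_card: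
  assumes "weighted_pure_complex n d T P" "\<tau> \<in> faces T i"
  shows "finite \<tau>" "card \<tau> = i"
  using finite_faces(2)[OF assms] assms(2) by (simp_all add: faces_def)

lemma up_comp_refl [simp]: "up_comp T i i g = g"
  by (simp add: up_comp_def)

lemma up_comp_Suc: "j \<le> i \<Longrightarrow> up_comp T j (Suc i) g = up_op T i (up_comp T j i g)"
  by (simp add: up_comp_def)

lemma up_comp_trans:
  assumes "j \<le> i" "i \<le> k"
  shows "up_comp T i k (up_comp T j i g) = up_comp T j k g"
  using assms(2,1) by (induction k rule: dec_induct) (simp_all add: up_comp_Suc)

text \<open>Elements of \<open>C\<^sub>i\<close> are represented by total functions, and identities
  between them hold on faces only. Such identities survive lifting because \<open>up_op\<close>
  evaluates its argument at faces alone.\<close>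

lemma up_comp_cong:
  assumes "i \<le> k" "\<And>\<sigma>. \<sigma> \<in> faces T i \<Longrightarrow> g \<sigma> = h \<sigma>" "\<tau> \<in> faces T k"
  shows "up_comp T i k g \<tau> = up_comp T i k h \<tau>"
  using assms(1,3)
proof (induction k arbitrary: \<tau> rule: dec_induct)
  case base
  then show ?case using assms(2) by simp
next
  case (step k)
  then show ?case by (simp add: up_comp_Suc up_op_def)
qed

lemma up_comp_linear:
  assumes "i \<le> k"
  shows "up_comp T i k (\<lambda>\<sigma>. \<Sum>j\<in>J. c j * g j \<sigma>) = (\<lambda>\<tau>. \<Sum>j\<in>J. c j * up_comp T i k (g j) \<tau>)"
  using assms
proof (induction k rule: dec_induct)
  case (step k)
  have "up_op T k (\<lambda>\<tau>. \<Sum>j\<in>J. c j * h j \<tau>) = (\<lambda>\<tau>. \<Sum>j\<in>J. c j * up_op T k (h j) \<tau>)" for h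
    unfolding up_op_def fun_eq_iff
    by (subst sum.swap) (simp add: sum_distrib_left mult.left_commute)
  then show ?case
    by (simp only: up_comp_Suc[OF step.hyps(1)] step.IH)
qed simp

text \<open>Induction on \<open>i\<close>: a \<open>j\<close>-subset of an
  \<open>(i + 1)\<close>-face lies in exactly \<open>i + 1 - j\<close> of its
  \<open>i\<close>-subsets, and the factor \<open>1 / (i + 1)\<close> in \<open>up_op\<close> turns
  this count into the ratio of consecutive binomial coefficients. Faces are closed under subsets, so
  the right-hand side can range over plain subsets.\<close>

lemma binomial_up_comp:
  assumes c: "weighted_pure_complex n d T P" and "j \<le> i" "\<tau> \<in> faces T i"
  shows "real (i choose j) * up_comp T j i g \<tau> = (\<Sum>\<sigma> | \<sigma> \<subseteq> \<tau> \<and> card \<sigma> = j. g \<sigma>)"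
  using assms(2,3)
proof (induction i arbitrary: \<tau> rule: dec_induct)
  case base
  have "card \<tau> = j" "finite \<tau>"
    using faces_finite_card[OF c base.prems] by simp_all
  then have "{\<sigma>. \<sigma> \<subseteq> \<tau> \<and> card \<sigma> = j} = {\<tau>}"
    by (auto dest: card_subset_eq)
  then show ?case by simp
next
  case (step i)
  have \<tau>: "finite \<tau>" "card \<tau> = Suc i"
    using faces_finite_card[OF c step.prems] by simp_all
  let ?R = "{\<rho>. \<rho> \<in> faces T i \<and> \<rho> \<subset> \<tau>}" and ?S = "{\<sigma>. \<sigma> \<subseteq> \<tau> \<and> card \<sigma> = j}"
  have fin: "finite ?R" "finite ?S"
    using \<tau>(1) finite_faces(1)[OF c] by auto
  have "(\<Sum>\<rho>\<in>?R. real (i choose j) * up_comp T j i g \<rho>) =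
      (\<Sum>\<rho>\<in>?R. \<Sum>\<sigma> | \<sigma> \<subseteq> \<rho> \<and> card \<sigma> = j. g \<sigma>)"
    using step.IH by (intro sum.cong) auto
  also have "\<dots> = (\<Sum>\<rho>\<in>?R. \<Sum>\<sigma> | \<sigma> \<in> ?S \<and> \<sigma> \<subseteq> \<rho>. g \<sigma>)"
    by (intro sum.cong) auto
  also have "\<dots> = (\<Sum>\<sigma>\<in>?S. \<Sum>\<rho> | \<rho> \<in> ?R \<and> \<sigma> \<subseteq> \<rho>. g \<sigma>)"
    using fin by (rule sum.swap_restrict)
  also have "\<dots> = (\<Sum>\<sigma>\<in>?S. real (Suc i - j) * g \<sigma>)"
  proof (rule sum.cong[OF refl])
    fix \<sigma> assume \<sigma>: "\<sigma> \<in> ?S"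
    \<comment> \<open>Every \<open>i\<close>-subset of \<tau> is a face, so
      \<open>card_between\<close> counts the \<rho> between \<sigma> and \<tau>.\<close>
    have "{\<rho>. \<rho> \<in> ?R \<and> \<sigma> \<subseteq> \<rho>} = {\<rho>. card \<rho> = i \<and> \<sigma> \<subseteq> \<rho> \<and> \<rho> \<subset> \<tau>}"
      using step.prems unfolding faces_def by blast
    then show "(\<Sum>\<rho> | \<rho> \<in> ?R \<and> \<sigma> \<subseteq> \<rho>. g \<sigma>) = real (Suc i - j) * g \<sigma>"
      using card_between[OF \<tau>, of \<sigma>] \<sigma> by simp
  qed
  finally have *: "real (i choose j) * (\<Sum>\<rho>\<in>?R. up_comp T j i g \<rho>) =
      real (Suc i - j) * (\<Sum>\<sigma>\<in>?S. g \<sigma>)"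
    by (simp add: sum_distrib_left)
  have "(Suc i - j) * (Suc i choose j) = Suc i * (i choose j)"
    using binomial_absorb_comp[of "Suc i" j] by simp
  then have b: "real (Suc i - j) * real (Suc i choose j) = real (Suc i) * real (i choose j)"
    by (metis of_nat_mult)
  \<comment> \<open>Both sides are compared after multiplication by \<open>Suc i - j\<close>:
    absorption then produces the factor \<open>Suc i\<close> that cancels the normalisation of
    \<open>up_op\<close>. The multiplier is nonzero since \<open>j \<le> i\<close>.\<close>
  have "real (Suc i - j) * (real (Suc i choose j) * up_comp T j (Suc i) g \<tau>) =
      real (Suc i) * real (i choose j) * up_comp T j (Suc i) g \<tau>"
    by (simp only: b mult.assoc[symmetric])
  also have "\<dots> = real (i choose j) * (\<Sum>\<rho>\<in>?R. up_comp T j i g \<rho>)"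
    using step.hyps by (simp add: up_comp_Suc up_op_def del: of_nat_Suc)
  finally have "real (Suc i - j) * (real (Suc i choose j) * up_comp T j (Suc i) g \<tau>) =
      real (Suc i - j) * (\<Sum>\<sigma>\<in>?S. g \<sigma>)"
    using * by simp
  then show ?case using step.hyps by simp
qed

lemma sum_subsets_by_card:
  fixes h :: "'a set \<Rightarrow> 'b::comm_monoid_add"
  assumes "finite \<tau>"
  shows "(\<Sum>\<sigma> | \<sigma> \<subseteq> \<tau>. h \<sigma>) = (\<Sum>j=0..card \<tau>. \<Sum>\<sigma> | \<sigma> \<subseteq> \<tau> \<and> card \<sigma> = j. h \<sigma>)"
proof -
  have "card ` Pow \<tau> \<subseteq> {0..card \<tau>}"
    using assms by (auto intro: card_mono)
  then show ?thesis
    using sum.group[of "Pow \<tau>" "{0..card \<tau>}" card h] assms by (simp add: Pow_def)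
qed

text \<open>In the recursion for \<open>level_fun\<close>, the term missing at \<open>j = i\<close>
  would have coefficient \<open>1\<close> and an empty lift, so it is the level function itself.
  Moving the subtracted sum to the other side completes it to a sum over all subsets of
  \<tau>.\<close>

lemma sum_level_fun:
  assumes c: "weighted_pure_complex n d T P" and \<tau>: "\<tau> \<in> faces T i"
  shows "(\<Sum>\<sigma> | \<sigma> \<subseteq> \<tau>. level_fun d T P k f (card \<sigma>) \<sigma>) = link_expectation d T P k f \<tau>"
proof -
  have f: "finite \<tau>" "card \<tau> = i"
    using faces_finite_card[OF c \<tau>] by simp_all
  have "(\<Sum>\<sigma> | \<sigma> \<subseteq> \<tau>. level_fun d T P k f (card \<sigma>) \<sigma>) =
      (\<Sum>j=0..i. \<Sum>\<sigma> | \<sigma> \<subseteq> \<tau> \<and> card \<sigma> = j. level_fun d T P k f j \<sigma>)"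
    by (simp add: sum_subsets_by_card f)
  also have "\<dots> = (\<Sum>j=0..i. real (i choose j) * up_comp T j i (level_fun d T P k f j) \<tau>)"
    using binomial_up_comp[OF c _ \<tau>] by (intro sum.cong) auto
  also have "\<dots> = level_fun d T P k f i \<tau> +
      (\<Sum>j<i. real (i choose j) * up_comp T j i (level_fun d T P k f j) \<tau>)"
    by (simp add: atLeast0AtMost flip: lessThan_Suc_atMost)
  also have "\<dots> = link_expectation d T P k f \<tau>"
    by (subst level_fun.simps) (simp add: link_expectation_def f)
  finally show ?thesis .
qed

lemma level_fun_moebius:
  assumes c: "weighted_pure_complex n d T P" and \<tau>: "\<tau> \<in> faces T i"
  shows "level_fun d T P k f i \<tau> =
    (\<Sum>\<sigma> | \<sigma> \<subseteq> \<tau>. (-1) ^ card (\<tau> - \<sigma>) * link_expectation d T P k f \<sigma>)"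
proof -
  \<comment> \<open>The level functions of all indices are glued into one set function, since the
    subsets of \<tau> have different sizes.\<close>
  let ?G = "\<lambda>\<sigma>. level_fun d T P k f (card \<sigma>) \<sigma>"
  have f: "finite \<tau>" "card \<tau> = i"
    using faces_finite_card[OF c \<tau>] by simp_all
  \<comment> \<open>The inversion needs its hypothesis on every finite set, but
    \<open>sum_level_fun\<close> covers faces only. Hence it is applied to
    \<open>sum ?G (Pow \<sigma>)\<close>, where the hypothesis is trivial; link expectations enter
    afterwards, for subsets of the face \<tau>.\<close>
  have "?G \<tau> = (\<Sum>\<sigma>\<in>Pow \<tau>. (-1) ^ (card \<tau> - card \<sigma>) * sum ?G (Pow \<sigma>))"
    using f(1) by (intro inclusion_exclusion_mobius) auto
  also have "\<dots> = (\<Sum>\<sigma>\<in>Pow \<tau>. (-1) ^ card (\<tau> - \<sigma>) * link_expectation d T P k f \<sigma>)"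
  proof (rule sum.cong[OF refl])
    fix \<sigma> assume "\<sigma> \<in> Pow \<tau>"
    then have "\<sigma> \<subseteq> \<tau>" by simp
    then have "card (\<tau> - \<sigma>) = card \<tau> - card \<sigma>"
      using f(1) by (simp add: card_Diff_subset finite_subset)
    moreover have "sum ?G (Pow \<sigma>) = link_expectation d T P k f \<sigma>"
      using sum_level_fun[OF c faces_downward[OF \<tau> \<open>\<sigma> \<subseteq> \<tau>\<close>]] by (simp add: Pow_def)
    ultimately show "(-1) ^ (card \<tau> - card \<sigma>) * sum ?G (Pow \<sigma>) =
        (-1) ^ card (\<tau> - \<sigma>) * link_expectation d T P k f \<sigma>"
      by simp
  qed
  finally show ?thesis using f by (simp add: Pow_def)
qed

text \<open>In the Moebius formula the sign depends only on \<open>card \<sigma>\<close>. Grouping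
  by this cardinality leaves unsigned sums over \<open>j\<close>-subsets, which
  \<open>binomial_up_comp\<close> converts back into lifts.\<close>

lemma level_fun_closed_form:
  assumes c: "weighted_pure_complex n d T P" and \<tau>: "\<tau> \<in> faces T i"
  shows "level_fun d T P k f i \<tau> =
    (\<Sum>j=0..i. (-1) ^ (i - j) * real (i choose j) * up_comp T j i (down_comp d T P k j f) \<tau>)"
proof -
  have f: "finite \<tau>" "card \<tau> = i"
    using faces_finite_card[OF c \<tau>] by simp_all
  have "level_fun d T P k f i \<tau> = (\<Sum>j=0..i. \<Sum>\<sigma> | \<sigma> \<subseteq> \<tau> \<and> card \<sigma> = j.
      (-1) ^ card (\<tau> - \<sigma>) * link_expectation d T P k f \<sigma>)"
    using level_fun_moebius[OF c \<tau>] sum_subsets_by_card[OF f(1)] f(2) by simp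
  also have "\<dots> = (\<Sum>j=0..i. (-1) ^ (i - j) *
      (\<Sum>\<sigma> | \<sigma> \<subseteq> \<tau> \<and> card \<sigma> = j. down_comp d T P k j f \<sigma>))"
    unfolding sum_distrib_left
    using f by (intro sum.cong)
      (auto simp: link_expectation_def card_Diff_subset finite_subset)
  also have "\<dots> = (\<Sum>j=0..i. (-1) ^ (i - j) *
      (real (i choose j) * up_comp T j i (down_comp d T P k j f) \<tau>))"
    using binomial_up_comp[OF c _ \<tau>] by (intro sum.cong) auto
  finally show ?thesis by (simp add: mult.assoc)
qed

text \<open>Lifting is linear, and a lift from \<open>j\<close> to \<open>i\<close> followed by one
  from \<open>i\<close> to \<open>k\<close> is the lift from \<open>j\<close> to
  \<open>k\<close>.\<close>

lemma level_lift_closed_form: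
  assumes c: "weighted_pure_complex n d T P" and "i \<le> k" and \<tau>: "\<tau> \<in> faces T k"
  shows "level_lift d T P k f i \<tau> = real (k choose i) *
    (\<Sum>j=0..i. (-1) ^ (i - j) * real (i choose j) * up_comp T j k (down_comp d T P k j f) \<tau>)"
proof -
  have "up_comp T i k (level_fun d T P k f i) \<tau> =
      up_comp T i k (\<lambda>\<sigma>. \<Sum>j=0..i. (-1) ^ (i - j) * real (i choose j) *
        up_comp T j i (down_comp d T P k j f) \<sigma>) \<tau>"
    using level_fun_closed_form[OF c] by (intro up_comp_cong \<open>i \<le> k\<close> \<tau>)
  also have "\<dots> = (\<Sum>j=0..i. (-1) ^ (i - j) * real (i choose j) *
      up_comp T j k (down_comp d T P k j f) \<tau>)"
    using \<open>i \<le> k\<close> by (auto simp: up_comp_linear up_comp_trans intro: sum.cong)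
  finally show ?thesis by (simp add: level_lift_def)
qed

lemma level_lift_eq_sum:
  assumes "weighted_pure_complex n d T P" and "i \<le> k" and "\<tau> \<in> faces T k"
  shows "level_lift d T P k f i \<tau> =
    (\<Sum>\<sigma> | \<sigma> \<subseteq> \<tau> \<and> card \<sigma> = i. level_fun d T P k f i \<sigma>)"
  using binomial_up_comp[OF assms] by (simp add: level_lift_def)

text \<open>Together the lifts sum the level functions over all subsets of \<tau>, which yields the
  link expectation at \<tau>.\<close>

lemma sum_level_lift:
  assumes c: "weighted_pure_complex n d T P" and \<tau>: "\<tau> \<in> faces T k"
  shows "(\<Sum>i=0..k. level_lift d T P k f i \<tau>) = f \<tau>"
proof -
  have fin: "finite \<tau>" "card \<tau> = k"
    using faces_finite_card[OF c \<tau>] by simp_all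
  have "(\<Sum>i=0..k. level_lift d T P k f i \<tau>) =
      (\<Sum>i=0..k. \<Sum>\<sigma> | \<sigma> \<subseteq> \<tau> \<and> card \<sigma> = i. level_fun d T P k f i \<sigma>)"
    using level_lift_eq_sum[OF c _ \<tau>] by (intro sum.cong) auto
  also have "\<dots> = link_expectation d T P k f \<tau>"
    using sum_level_fun[OF c \<tau>] by (simp add: sum_subsets_by_card fin)
  also have "\<dots> = f \<tau>"
    \<comment> \<open>At a \<open>k\<close>-face no averaging is left: the list of indices in
      \<open>down_comp\<close> is empty.\<close>
    using fin by (simp add: link_expectation_def down_comp_def)
  finally show ?thesis .
qed

theorem mainTheorem9:
  fixes n d k :: nat
    and T :: "nat set set"
    and P :: "nat set pmf"
    and f :: "nat set \<Rightarrow> real"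
  assumes "weighted_pure_complex n d T P"
    and "k \<le> d"
  shows "(\<forall>\<tau>\<in>faces T k. f \<tau> = (\<Sum>i=0..k. level_lift d T P k f i \<tau>)) \<and>
    (\<forall>i\<le>k.
      (\<forall>\<tau>\<in>faces T i. level_fun d T P k f i \<tau> =
        (\<Sum>j=0..i. (-1) ^ (i - j) * real (i choose j) *
          up_comp T j i (down_comp d T P k j f) \<tau>)) \<and>
      (\<forall>\<tau>\<in>faces T k. level_lift d T P k f i \<tau> =
        real (k choose i) * (\<Sum>j=0..i. (-1) ^ (i - j) * real (i choose j) *
          up_comp T j k (down_comp d T P k j f) \<tau>)) \<and>
      (\<forall>\<tau>\<in>faces T i. level_fun d T P k f i \<tau> =
        (\<Sum>\<sigma> | \<sigma> \<subseteq> \<tau>. (-1) ^ card (\<tau> - \<sigma>) * link_expectation d T P k f \<sigma>)) \<and>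
      (\<forall>\<tau>\<in>faces T k. level_lift d T P k f i \<tau> =
        (\<Sum>\<sigma> | \<sigma> \<in> faces T i \<and> \<sigma> \<subseteq> \<tau>. level_fun d T P k f i \<sigma>)))"
proof -
  \<comment> \<open>Downward closure identifies the \<open>i\<close>-faces inside \<tau> with its
    \<open>i\<close>-subsets, the index set used in \<open>level_lift_eq_sum\<close>.\<close>
  have "{\<sigma>. \<sigma> \<in> faces T i \<and> \<sigma> \<subseteq> \<tau>} = {\<sigma>. \<sigma> \<subseteq> \<tau> \<and> card \<sigma> = i}" if "\<tau> \<in> faces T k" for i \<tau>
    using that unfolding faces_def by blast
  then have "level_lift d T P k f i \<tau> =
      (\<Sum>\<sigma> | \<sigma> \<in> faces T i \<and> \<sigma> \<subseteq> \<tau>. level_fun d T P k f i \<sigma>)"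
    if "i \<le> k" "\<tau> \<in> faces T k" for i \<tau>
    using that level_lift_eq_sum[OF assms(1)] by simp
  then show ?thesis
    using level_fun_closed_form[OF assms(1)] level_lift_closed_form[OF assms(1)]
      level_fun_moebius[OF assms(1)] sum_level_lift[OF assms(1), symmetric]
    by (intro conjI allI impI ballI)
qed

end
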